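(* Let $M,A\in\mathbb{N}$ with $M\ge 3$ and $\delta=\log A/\log M\in(0,2/3)$. Suppose that $\varepsilon>0$. Then there exists a set $\mathbb{G}=\mathbb{G}(M,\varepsilon)\subset\mathbb{A}(M,A)$ with $$\mu\big(\mathbb{A}(M,A)\setminus\mathbb{G}\big)\le 4M e^{-\frac{M^{4\varepsilon}}{64}}$$ such that for all $\mathcal{A}\in\mathbb{G}$, $$\beta^s(M,\mathcal{A})\ge\frac12-\frac34\delta-\varepsilon.$$
   Context: $\mathbb{A}(M,A)=\{\mathcal{A}\subset\{0,\dots,M-1\}:\mathrm{Card}(\mathcal{A})=A\}$ is the space of alphabets of cardinality $A$, and $\mu$ is the uniform counting probability measure on it: $\mu(\Omega)=\mathrm{Card}(\Omega)/\binom{M}{A}$ for $\Omega\subset\mathbb{A}(M,A)$. For an alphabet $\mathcal{A}\subset\{0,\dots,M-1\}$ and $k\in\mathbb{N}=\{1,2,\dots\}$, the discrete Cantor set is $$\mathcal{C}_k=\mathcal{C}_k(M,\mathcal{A})=\Big\{\sum_{j=0}^{k-1}a_jM^j: a_0,\dots,a_{k-1}\in\mathcal{A}\Big\}\subset\{0,\dots,M^k-1\}.$$ For $N\in\mathbb{N}$, $l^2_N$ is the Hilbert space of functions $u:\{0,\dots,N-1\}\to\mathbb{C}$ with $\|u\|_{l^2_N}^2=\sum_{j=0}^{N-1}|u(j)|^2$, and $\mathcal{F}_N:l^2_N\to l^2_N$ is the unitary discrete Fourier transform $$\mathcal{F}_Nu(j)=\frac{1}{\sqrt N}\sum_{l=0}^{N-1}e^{-\frac{2\pi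 i jl}{N}}u(l).$$ With $N=M^k$, set $r_k=\|1_{\mathcal{C}_k}\mathcal{F}_N1_{\mathcal{C}_k}\|_{l^2_N\to l^2_N}$ (operator norm), where $1_{\mathcal{C}_k}$ denotes multiplication by the indicator function of $\mathcal{C}_k$. The sharp exponent in the fractal uncertainty principle is $$\beta^s(M,\mathcal{A})=\sup\{\beta\ge0: r_k\le N^{-\beta}\text{ with } N=M^k,\text{ for all }k\in\mathbb{N}\}.$$ *)

theory Defs
  imports "HOL-Analysis.Analysis"
begin

definition alphabets :: "nat \<Rightarrow> nat \<Rightarrow> nat set set" where
  "alphabets M A = {\<A>. \<A> \<subseteq> {0..<M} \<and> card \<A> = A}"

definition alphabet_measure :: "nat \<Rightarrow> nat \<Rightarrow> nat set measure" where
  "alphabet_measure M A = uniform_count_measure (alphabets M A)"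

lemma measure_alphabet_measure:
  assumes "\<Omega> \<subseteq> alphabets M A"
  shows "measure (alphabet_measure M A) \<Omega> = real (card \<Omega>) / real (M choose A)"
proof -
  have "finite (alphabets M A)"
    by (rule finite_subset[of _ "Pow {0..<M}"]) (auto simp: alphabets_def)
  moreover have "card (alphabets M A) = M choose A"
    using n_subsets[of "{0..<M}" A] by (simp add: alphabets_def)
  ultimately show ?thesis
    using assms by (simp add: alphabet_measure_def measure_uniform_count_measure)
qed

definition cantor_set :: "nat \<Rightarrow> nat set \<Rightarrow> nat \<Rightarrow> nat set" where
  "cantor_set M \<A> k = {(\<Sum>j<k. a j * M ^ j) | a. \<forall>j<k. a j \<in> \<A>}"

(* Functions on {0,...,N-1} are represented by their extension by zero to all of nat.
   The dimension N = M^k varies inside the definition of the uncertainty exponent, so it cannot be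
   encoded in a type, and the norm and the operator norm are defined relative to N. *)
definition l2_space :: "nat \<Rightarrow> (nat \<Rightarrow> complex) set" where
  "l2_space N = {u. \<forall>j\<ge>N. u j = 0}"

definition l2_norm :: "nat \<Rightarrow> (nat \<Rightarrow> complex) \<Rightarrow> real" where
  "l2_norm N u = sqrt (\<Sum>j<N. (cmod (u j))\<^sup>2)"

(* The relativised form of the library's onorm, with the same convention 0 / 0 = 0. *)
definition l2_onorm :: "nat \<Rightarrow> ((nat \<Rightarrow> complex) \<Rightarrow> (nat \<Rightarrow> complex)) \<Rightarrow> real" where
  "l2_onorm N T = (SUP u\<in>l2_space N. l2_norm N (T u) / l2_norm N u)"

definition dft :: "nat \<Rightarrow> (nat \<Rightarrow> complex) \<Rightarrow> (nat \<Rightarrow> complex)" where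
  "dft N u = (\<lambda>j. if j < N
     then 1 / complex_of_real (sqrt (real N)) *
       (\<Sum>l<N. exp (- (2 * complex_of_real pi * \<i> * of_nat j * of_nat l / of_nat N)) * u l)
     else 0)"

definition mult_indicator :: "nat set \<Rightarrow> (nat \<Rightarrow> complex) \<Rightarrow> (nat \<Rightarrow> complex)" where
  "mult_indicator X u = (\<lambda>j. indicator X j * u j)"

definition fup_norm :: "nat \<Rightarrow> nat set \<Rightarrow> nat \<Rightarrow> real" where
  "fup_norm M \<A> k =
     l2_onorm (M ^ k)
       (mult_indicator (cantor_set M \<A> k) \<circ> dft (M ^ k) \<circ> mult_indicator (cantor_set M \<A> k))"

(* For M \<ge> 2 and nonempty \<A> \<subseteq> {0..<M} the set below contains 0, since every
   fup_norm is at most 1, and is bounded above, since fup_norm M \<A> 1 > 0; so the supremum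
   in the reals is the genuine one.  For empty \<A> it would be infinite. *)
definition sharp_exponent :: "nat \<Rightarrow> nat set \<Rightarrow> real" where
  "sharp_exponent M \<A> =
     Sup {\<beta>. 0 \<le> \<beta> \<and> (\<forall>k\<ge>1. fup_norm M \<A> k \<le> real (M ^ k) powr (- \<beta>))}"

end

theory Submission
  imports Defs "HOL-Probability.Hoeffding"
begin

text \<open>
  Two facts combine. The first is that the operator norms are submultiplicative,
  so \<open>r\<^sub>k \<le> r\<^sub>1 ^ k\<close> and only the Fourier matrix restricted to the alphabet itself has to
  be estimated; this is \<open>dft_energy_le_cantor_set\<close>, which rests on the factorisation of a
  Fourier transform of length \<open>M * K\<close> into transforms of lengths \<open>M\<close> and \<open>K\<close>
  (\<open>dft_energy_le_product\<close>).

  The second is that \<open>r\<^sub>1\<close> is controlled by the Fourier coefficients of the alphabet. By the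
  \<open>T\<^sup>* T\<close> argument and Schur's test (\<open>restricted_dft_bound\<close>), \<open>M * r\<^sub>1\<^sup>2\<close> is at most the largest
  row sum of the Gram matrix, whose entries are the sums
  \<open>\<Sum>a\<in>\<A>. exp (- 2 * pi * \<i> * a * m / M)\<close>. The diagonal entry is \<open>A\<close>. For a random alphabet,
  an off-diagonal entry is a sum of \<open>A\<close> unit vectors drawn without replacement from a
  population of mean zero, hence should not exceed \<open>sqrt A\<close> by much. If all of them are at most
  \<open>sqrt A * X / 4\<close> with \<open>X = M powr (2 * \<epsilon>)\<close>, then
  \<open>M * r\<^sub>1\<^sup>2 \<le> A + A * sqrt A * X / 4 \<le> A powr (3 / 2) * X\<close>,
  and \<open>A = M powr \<delta>\<close> turns this into \<open>r\<^sub>1 \<le> M powr - (1 / 2 - 3 / 4 * \<delta> - \<epsilon>)\<close>.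

  The probability of failure is a union bound over fewer than \<open>M\<close> frequencies and the four
  signed real and imaginary parts, each with the tail \<open>exp (- X\<^sup>2 / 64)\<close> given by Hoeffding's
  inequality for sampling without replacement (\<open>hoeffding_without_replacement\<close>). That
  inequality follows by Chernoff's method: the exponential moment over a random subset is a
  normalised elementary symmetric polynomial, and Maclaurin's inequality
  (\<open>maclaurin_elementary_symmetric\<close>) compares it with the moment for independent samples.
\<close>

section \<open>Sampling without replacement\<close>

text \<open>
  The weighted arithmetic-geometric mean inequality for \<open>m ^ Suc k\<close> and \<open>y ^ Suc k\<close>, cleared of
  denominators. In the induction step the surplus is a multiple of \<open>(m - y)\<^sup>2\<close>.
\<close>
lemma weighted_power_am_gm:
  fixes m y :: real
  assumes "m \<ge> 0" "y \<ge> 0"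
  shows "0 \<le> m ^ Suc k - real (Suc k) * m * y ^ k + real k * y ^ Suc k"
proof (induction k)
  case 0
  then show ?case by simp
next
  case (Suc k)
  have "m ^ Suc (Suc k) - real (Suc (Suc k)) * m * y ^ Suc k + real (Suc k) * y ^ Suc (Suc k)
    = m * (m ^ Suc k - real (Suc k) * m * y ^ k + real k * y ^ Suc k)
      + real (Suc k) * y ^ k * (m - y)\<^sup>2"
    by (simp add: algebra_simps power2_eq_square)
  also have "\<dots> \<ge> 0"
    by (intro add_nonneg_nonneg mult_nonneg_nonneg assms Suc.IH of_nat_0_le_iff
        zero_le_power zero_le_power2)
  finally show ?case .
qed

text \<open>
  The right-hand side is the tangent line at \<open>y = m\<close> of the left-hand side as a function of \<open>y\<close>.
  That function is not concave near \<open>0\<close>, so the tangent bound needs an argument: the gap is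
  affine in \<open>n\<close> with slope \<open>(y - m) * (y ^ k - m ^ k) \<ge> 0\<close>, and at the smallest admissible value
  \<open>n = Suc k\<close> it is the quantity of the previous lemma.
\<close>
lemma power_tangent_bound:
  fixes m y n :: real
  assumes "m \<ge> 0" "y \<ge> 0" "n \<ge> real (Suc k)"
  shows "(n * m - (n - 1) * y) * y ^ k \<le> m ^ Suc k + (real (Suc k) - n) * m ^ k * (y - m)"
proof -
  have "0 \<le> (y - m) * (y ^ k - m ^ k)"
  proof (cases "m \<le> y")
    case True
    then show ?thesis using assms by (intro mult_nonneg_nonneg) (auto intro: power_mono)
  next
    case False
    then show ?thesis using assms by (intro mult_nonpos_nonpos) (auto intro: power_mono)
  qed
  then have "0 \<le> (n - real (Suc k)) * ((y - m) * (y ^ k - m ^ k))"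
    using assms(3) by (intro mult_nonneg_nonneg[of "n - real (Suc k)"]) simp_all
  with weighted_power_am_gm[OF assms(1,2), of k]
  have "0 \<le> (m ^ Suc k - real (Suc k) * m * y ^ k + real k * y ^ Suc k)
    + (n - real (Suc k)) * ((y - m) * (y ^ k - m ^ k))" by linarith
  also have "\<dots> = m ^ Suc k + (real (Suc k) - n) * m ^ k * (y - m) - (n * m - (n - 1) * y) * y ^ k"
    by (simp add: algebra_simps)
  finally show ?thesis by simp
qed

text \<open>
  Double counting of the pairs of a set of size \<open>Suc k\<close> and a distinguished element in it.
\<close>
lemma sum_prod_subsets_Suc:
  fixes g :: "'a \<Rightarrow> real"
  assumes "finite I"
  shows "real (Suc k) * (\<Sum>S | S \<subseteq> I \<and> card S = Suc k. \<Prod>i\<in>S. g i)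
    = (\<Sum>i\<in>I. g i * (\<Sum>T | T \<subseteq> I - {i} \<and> card T = k. \<Prod>j\<in>T. g j))"
proof -
  have fin: "finite {S. S \<subseteq> J \<and> P S}" if "J \<subseteq> I" for J and P :: "'a set \<Rightarrow> bool"
    by (rule finite_subset[of _ "Pow I"]) (use that assms in auto)
  have "real (Suc k) * (\<Sum>S | S \<subseteq> I \<and> card S = Suc k. \<Prod>i\<in>S. g i)
    = (\<Sum>S | S \<subseteq> I \<and> card S = Suc k. \<Sum>i\<in>S. \<Prod>i\<in>S. g i)"
    by (simp add: sum_distrib_left)
  also have "\<dots> = (\<Sum>(S, i)\<in>(SIGMA S:{S. S \<subseteq> I \<and> card S = Suc k}. S). \<Prod>i\<in>S. g i)"
    by (intro sum.Sigma fin) (auto intro: finite_subset[OF _ assms])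
  also have "\<dots> = (\<Sum>(i, T)\<in>(SIGMA i:I. {T. T \<subseteq> I - {i} \<and> card T = k}). g i * (\<Prod>j\<in>T. g j))"
  proof (rule sum.reindex_bij_witness[where j = "\<lambda>(S, i). (i, S - {i})"
        and i = "\<lambda>(i, T). (insert i T, i)"], goal_cases)
    case (5 p)
    then show ?case
      by (auto simp: prod.remove finite_subset[OF _ assms])
  next
    case (4 p)
    then obtain i T where p: "p = (i, T)" "i \<in> I" "T \<subseteq> I - {i}" "card T = k" by auto
    then have "finite T" "i \<notin> T" using assms finite_subset by auto
    with p show ?case by auto
  next
    case (2 p)
    then show ?case using finite_subset[OF _ assms] by (auto simp: card_Diff_singleton)
  qed auto
  also have "\<dots> = (\<Sum>i\<in>I. \<Sum>T | T \<subseteq> I - {i} \<and> card T = k. g i * (\<Prod>j\<in>T. g j))"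
    by (intro sum.Sigma[symmetric] assms ballI fin) auto
  finally show ?thesis by (simp add: sum_distrib_left)
qed

text \<open>
  Maclaurin's inequality between the first and the \<open>k\<close>-th elementary symmetric polynomial.
  Double counting expresses the polynomial of degree \<open>Suc k\<close> through those of degree \<open>k\<close> in
  the variables other than \<open>i\<close>, which the induction hypothesis bounds by powers of the means
  \<open>y i\<close> of the remaining variables. Since \<open>g i\<close> is an affine function of \<open>y i\<close> and the \<open>y i\<close> have
  the same mean \<open>m\<close> as \<open>g\<close>, summing the tangent bound at \<open>m\<close> removes the linear term.
\<close>
theorem maclaurin_elementary_symmetric:
  fixes g :: "'a \<Rightarrow> real"
  assumes "finite I" "k \<le> card I" "\<And>i. i \<in> I \<Longrightarrow> g i \<ge> 0"
  shows "(\<Sum>S | S \<subseteq> I \<and> card S = k. \<Prod>i\<in>S. g i)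
    \<le> real (card I choose k) * ((\<Sum>i\<in>I. g i) / real (card I)) ^ k"
  using assms
proof (induction k arbitrary: I)
  case 0
  then have "{S. S \<subseteq> I \<and> card S = 0} = {{}}"
    by (auto dest: finite_subset)
  then show ?case by simp
next
  case (Suc k)
  define n where "n = card I"
  define s where "s = (\<Sum>i\<in>I. g i)"
  define m where "m = s / real n"
  define y where "y i = (\<Sum>j\<in>I - {i}. g j) / real (n - 1)" for i
  have n: "Suc k \<le> n" using Suc.prems by (simp add: n_def)
  have nm: "real n * m = s" using n by (simp add: m_def)
  have m0: "m \<ge> 0" unfolding m_def s_def using Suc.prems(3) by (intro divide_nonneg_nonneg sum_nonneg) auto
  have y0: "y i \<ge> 0" for i unfolding y_def using Suc.prems(3) by (intro divide_nonneg_nonneg sum_nonneg) auto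
  have ny: "real (n - 1) * y i = s - g i" if "i \<in> I" for i
  proof (cases "n = 1")
    case True
    then have "I = {i}" using that by (metis card_1_singletonE n_def singletonD)
    then show ?thesis by (simp add: y_def s_def)
  next
    case False
    then show ?thesis using n Suc.prems(1) that by (simp add: y_def s_def sum_diff1)
  qed
  have "real (Suc k) * (\<Sum>S | S \<subseteq> I \<and> card S = Suc k. \<Prod>i\<in>S. g i)
      = (\<Sum>i\<in>I. g i * (\<Sum>T | T \<subseteq> I - {i} \<and> card T = k. \<Prod>j\<in>T. g j))"
    by (rule sum_prod_subsets_Suc) fact
  also have "\<dots> \<le> (\<Sum>i\<in>I. g i * (real (n - 1 choose k) * y i ^ k))"
  proof (intro sum_mono mult_left_mono)
    fix i assume i: "i \<in> I"
    have "card (I - {i}) = n - 1" using i Suc.prems(1) by (simp add: n_def)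
    with Suc.IH[of "I - {i}"] Suc.prems n i
    show "(\<Sum>T | T \<subseteq> I - {i} \<and> card T = k. \<Prod>j\<in>T. g j) \<le> real (n - 1 choose k) * y i ^ k"
      by (simp add: y_def)
  qed (use Suc.prems in auto)
  also have "\<dots> = real (n - 1 choose k) * (\<Sum>i\<in>I. (real n * m - (real n - 1) * y i) * y i ^ k)"
    unfolding sum_distrib_left
  proof (intro sum.cong refl)
    fix i assume "i \<in> I"
    then have "g i = real n * m - (real n - 1) * y i" using ny[of i] nm n by (simp add: of_nat_diff)
    then show "g i * (real (n - 1 choose k) * y i ^ k)
      = real (n - 1 choose k) * ((real n * m - (real n - 1) * y i) * y i ^ k)" by simp
  qed
  also have "\<dots> \<le> real (n - 1 choose k) *
      (\<Sum>i\<in>I. m ^ Suc k + (real (Suc k) - real n) * m ^ k * (y i - m))"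
    using n by (intro mult_left_mono sum_mono power_tangent_bound m0 y0) auto
  also have "(\<Sum>i\<in>I. m ^ Suc k + (real (Suc k) - real n) * m ^ k * (y i - m))
      = real n * m ^ Suc k + (real (Suc k) - real n) * m ^ k * ((\<Sum>i\<in>I. y i) - real n * m)"
    by (simp add: sum.distrib sum_distrib_left[symmetric] sum_subtractf n_def)
  \<comment> \<open>for a single variable \<open>y\<close> is \<open>0 / 0 = 0\<close>, but then \<open>k = 0\<close> and the other factor vanishes\<close>
  also have "(real (Suc k) - real n) * m ^ k * ((\<Sum>i\<in>I. y i) - real n * m) = 0"
  proof (cases "n = 1")
    case True
    then show ?thesis using n by simp
  next
    case False
    have "real (n - 1) * (\<Sum>i\<in>I. y i) = (\<Sum>i\<in>I. s - g i)"
      using ny by (simp add: sum_distrib_left)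
    also have "\<dots> = real (n - 1) * s"
      using n by (simp add: sum_subtractf s_def n_def of_nat_diff algebra_simps)
    finally show ?thesis using False n nm by simp
  qed
  also have "real (n - 1 choose k) * (real n * m ^ Suc k + 0) = real (Suc k) * (real (n choose Suc k) * m ^ Suc k)"
  proof -
    have "Suc k * (n choose Suc k) = n * (n - 1 choose k)"
      using Suc_times_binomial_eq[of "n - 1" k] n by (simp add: mult.commute)
    then have "real (Suc k) * real (n choose Suc k) = real n * real (n - 1 choose k)"
      by (metis of_nat_mult)
    then show ?thesis by (simp only: mult.assoc[symmetric]) simp
  qed
  finally have "real (Suc k) * (\<Sum>S | S \<subseteq> I \<and> card S = Suc k. \<Prod>i\<in>S. g i)
    \<le> real (Suc k) * (real (n choose Suc k) * m ^ Suc k)" .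
  then have "(\<Sum>S | S \<subseteq> I \<and> card S = Suc k. \<Prod>i\<in>S. g i) \<le> real (n choose Suc k) * m ^ Suc k"
    by (simp only: mult_le_cancel_left_pos of_nat_0_less_iff zero_less_Suc)
  then show ?case by (simp add: n_def m_def s_def)
qed

text \<open>
  The case of a symmetric random sign in Hoeffding's lemma.
\<close>
lemma cosh_le_exp_half_square:
  fixes x :: real
  shows "cosh x \<le> exp (x\<^sup>2 / 2)"
proof -
  have *: "cosh x \<le> exp (x\<^sup>2 / 2)" if "x \<ge> 0" for x :: real
  proof -
    have pos: "0 < 1 + 1 / 2 * (exp (2 * x) - 1)" by (simp add: field_simps add_pos_pos)
    have "cosh x = exp (- x) * (1 + 1 / 2 * (exp (2 * x) - 1))"
      by (simp add: cosh_field_def field_simps exp_minus mult_exp_exp)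
    also have "\<dots> = exp (- x + ln (1 + 1 / 2 * (exp (2 * x) - 1)))"
      using pos by (simp only: exp_add exp_ln)
    also have "\<dots> \<le> exp (x\<^sup>2 / 2)"
      using Hoeffdings_lemma_aux[of "2 * x" "1 / 2"] that by (simp add: power_mult_distrib)
    finally show ?thesis .
  qed
  show ?thesis using *[of "\<bar>x\<bar>"] by simp
qed

text \<open>
  By convexity, the exponential lies below its chord through \<open>x = - 1\<close> and \<open>x = 1\<close>. For a mean
  zero population the linear term of the chord averages out, which leaves \<open>cosh l\<close>.
\<close>
lemma exp_mult_le_cosh_sinh:
  fixes x l :: real
  assumes "\<bar>x\<bar> \<le> 1"
  shows "exp (l * x) \<le> cosh l + x * sinh l"
proof -
  have "exp ((1 - (1 - x) / 2) *\<^sub>R l + ((1 - x) / 2) *\<^sub>R (- l))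
      \<le> (1 - (1 - x) / 2) * exp l + (1 - x) / 2 * exp (- l)"
    using assms by (intro convex_onD[OF exp_convex]) auto
  moreover have "(1 - (1 - x) / 2) *\<^sub>R l + ((1 - x) / 2) *\<^sub>R (- l) = l * x"
    by (simp add: field_simps)
  ultimately have "exp (l * x) \<le> (1 - (1 - x) / 2) * exp l + (1 - x) / 2 * exp (- l)"
    by simp
  then show ?thesis by (simp add: cosh_field_def sinh_field_def field_simps)
qed


lemma sum_exp_le:
  fixes f :: "'a \<Rightarrow> real"
  assumes "finite I" "\<And>i. i \<in> I \<Longrightarrow> \<bar>f i\<bar> \<le> 1" "(\<Sum>i\<in>I. f i) = 0"
  shows "(\<Sum>i\<in>I. exp (l * f i)) \<le> real (card I) * exp (l\<^sup>2 / 2)"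
proof -
  have "(\<Sum>i\<in>I. exp (l * f i)) \<le> (\<Sum>i\<in>I. cosh l + f i * sinh l)"
    by (intro sum_mono exp_mult_le_cosh_sinh assms)
  also have "\<dots> = real (card I) * cosh l"
    using assms(3) by (simp add: sum.distrib sum_distrib_right[symmetric])
  also have "\<dots> \<le> real (card I) * exp (l\<^sup>2 / 2)"
    by (intro mult_left_mono cosh_le_exp_half_square) auto
  finally show ?thesis .
qed

text \<open>
  Chernoff's method: by Maclaurin's inequality the exponential moment of the sum over a random
  subset of size \<open>k\<close> is at most the \<open>k\<close>-th power of that of a single draw, just as for
  independent draws.
\<close>
theorem hoeffding_without_replacement:
  fixes f :: "'a \<Rightarrow> real"
  assumes "finite I" "0 < k" "k \<le> card I" "t \<ge> 0"
    and "\<And>i. i \<in> I \<Longrightarrow> \<bar>f i\<bar> \<le> 1" "(\<Sum>i\<in>I. f i) = 0"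
  shows "real (card {S. S \<subseteq> I \<and> card S = k \<and> t \<le> (\<Sum>i\<in>S. f i)})
    \<le> real (card I choose k) * exp (- t\<^sup>2 / (2 * real k))"
proof -
  \<comment> \<open>this value of \<open>l\<close> minimises \<open>k * l\<^sup>2 / 2 - l * t\<close>\<close>
  define l where "l = t / real k"
  have l: "l \<ge> 0" using assms by (simp add: l_def)
  let ?B = "{S. S \<subseteq> I \<and> card S = k \<and> t \<le> (\<Sum>i\<in>S. f i)}"
  have fin: "finite {S. S \<subseteq> I \<and> P S}" for P
    by (rule finite_subset[of _ "Pow I"]) (use assms in auto)
  have "real (card ?B) * exp (l * t) = (\<Sum>S\<in>?B. exp (l * t))" by simp
  also have "\<dots> \<le> (\<Sum>S\<in>?B. exp (l * (\<Sum>i\<in>S. f i)))"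
    using l by (intro sum_mono) (auto intro: mult_left_mono)
  also have "\<dots> \<le> (\<Sum>S | S \<subseteq> I \<and> card S = k. exp (l * (\<Sum>i\<in>S. f i)))"
    by (intro sum_mono2 fin) auto
  also have "\<dots> = (\<Sum>S | S \<subseteq> I \<and> card S = k. \<Prod>i\<in>S. exp (l * f i))"
    using finite_subset[OF _ assms(1)] by (intro sum.cong) (auto simp: exp_sum sum_distrib_left)
  also have "\<dots> \<le> real (card I choose k) * ((\<Sum>i\<in>I. exp (l * f i)) / real (card I)) ^ k"
    using assms by (intro maclaurin_elementary_symmetric) auto
  also have "\<dots> \<le> real (card I choose k) * exp (l\<^sup>2 / 2) ^ k"
  proof (intro mult_left_mono power_mono)
    show "(\<Sum>i\<in>I. exp (l * f i)) / real (card I) \<le> exp (l\<^sup>2 / 2)"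
      using sum_exp_le[OF assms(1,5,6), of l] assms(2,3)
      by (simp add: divide_le_eq mult.commute)
  qed (auto intro!: divide_nonneg_nonneg sum_nonneg)
  also have "exp (l\<^sup>2 / 2) ^ k = exp (- t\<^sup>2 / (2 * real k)) * exp (l * t)"
    using assms(2) by (simp add: exp_of_nat_mult[symmetric] mult_exp_exp l_def field_simps power2_eq_square)
  finally show ?thesis by simp
qed

section \<open>Fourier matrices restricted to a set\<close>

definition dft_char :: "nat \<Rightarrow> nat \<Rightarrow> complex" where
  "dft_char N n = cis (- (2 * pi * real n / real N))"

lemma norm_dft_char [simp]: "cmod (dft_char N n) = 1"
  by (simp add: dft_char_def)

lemma dft_char_0 [simp]: "dft_char N 0 = 1"
  by (simp add: dft_char_def)

lemma dft_char_add: "dft_char N (m + n) = dft_char N m * dft_char N n"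
  by (simp add: dft_char_def cis_mult add_divide_distrib ring_distribs)

lemma dft_char_mult_cnj: "dft_char N n * cnj (dft_char N n) = 1"
  using complex_norm_square[of "dft_char N n"] by simp

lemma dft_char_mult_left:
  assumes "K > 0"
  shows "dft_char (M * K) (K * n) = dft_char M n"
  using assms by (simp add: dft_char_def mult.assoc)

lemma dft_char_mult_period [simp]:
  assumes "N > 0"
  shows "dft_char N (N * q) = 1"
proof -
  have "- (2 * pi * real q) = 2 * pi * of_int (- int q)" by simp
  then show ?thesis using assms cis_multiple_2pi[of "of_int (- int q)"]
    by (simp add: dft_char_def mult.assoc)
qed

lemma sum_dft_char_eq_0:
  assumes "0 < m" "m < N"
  shows "(\<Sum>j<N. dft_char N (j * m)) = 0"
proof -
  have pow: "dft_char N (j * m) = dft_char N m ^ j" for j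
    by (induction j) (simp_all add: dft_char_add)
  have "dft_char N m \<noteq> 1"
  proof
    assume "dft_char N m = 1"
    then have "cos (2 * pi * real m / real N) = 1"
      by (simp add: dft_char_def complex_eq_iff)
    then obtain x :: int where "2 * pi * real m / real N = of_int x * (2 * pi)"
      using cos_one_2pi_int by auto
    then have "(2 * pi) * (real m / real N) = (2 * pi) * of_int x" by (simp add: mult_ac)
    then have x: "real m / real N = of_int x"
      by (simp only: mult_cancel_left) simp
    have "0 < real m / real N" "real m / real N < 1" using assms by auto
    then show False unfolding x by simp
  qed
  moreover have "dft_char N m ^ N = 1"
    using assms pow[of N, symmetric] by simp
  ultimately show ?thesis by (simp add: pow geometric_sum)
qed

text \<open>
  Expanding the square gives the quadratic form of the Gram matrix \<open>G\<close> of the columns. The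
  modulus of its entry at \<open>l\<close>, \<open>l'\<close> depends only on the distance of \<open>l\<close> and \<open>l'\<close> and is the one
  of a character sum over \<open>J\<close>, so \<open>card J + card L * T\<close> bounds every absolute row sum. Schur's
  test finishes the proof. The sets of rows and columns are kept apart because \<open>J = {..<N}\<close>,
  where \<open>T = 0\<close>, yields Bessel's inequality, whereas \<open>J = L\<close> yields the gain for alphabets.
\<close>
lemma restricted_dft_bound:
  assumes "finite J" "L \<subseteq> {..<N}" "T \<ge> 0"
    and T: "\<And>m. 0 < m \<Longrightarrow> m < N \<Longrightarrow> cmod (\<Sum>j\<in>J. dft_char N (j * m)) \<le> T"
  shows "(\<Sum>j\<in>J. (cmod (\<Sum>l\<in>L. dft_char N (j * l) * u l))\<^sup>2)
    \<le> (real (card J) + real (card L) * T) * (\<Sum>l\<in>L. (cmod (u l))\<^sup>2)"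
proof -
  have finL: "finite L" using assms(2) finite_subset by blast
  define G where "G l l' = (\<Sum>j\<in>J. dft_char N (j * l) * cnj (dft_char N (j * l')))" for l l'
  have G_diff: "G l l' = (\<Sum>j\<in>J. dft_char N (j * (l - l')))" if "l' \<le> l" for l l'
  proof -
    have "dft_char N (j * l) * cnj (dft_char N (j * l')) = dft_char N (j * (l - l'))" for j
    proof -
      have "j * l = j * l' + j * (l - l')" using that by (simp add: ring_distribs[symmetric])
      then have "dft_char N (j * l) = dft_char N (j * l') * dft_char N (j * (l - l'))"
        by (simp only: dft_char_add)
      then show ?thesis using dft_char_mult_cnj[of N "j * l'"] by (simp add: mult_ac)
    qed
    then show ?thesis by (simp add: G_def)
  qed
  have G_norm_sym: "cmod (G l l') = cmod (G l' l)" for l l'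
  proof -
    have "G l l' = cnj (G l' l)" by (simp add: G_def mult.commute)
    then show ?thesis by (simp only: complex_mod_cnj)
  qed
  have G_le: "cmod (G l l') \<le> T" if "l \<in> L" "l' \<in> L" "l \<noteq> l'" for l l'
  proof (cases "l' < l")
    case True
    then show ?thesis using T[of "l - l'"] G_diff[of l' l] that assms(2) by auto
  next
    case False
    then show ?thesis using T[of "l' - l"] G_diff[of l l'] that assms(2) G_norm_sym[of l l'] by auto
  qed
  have G_row: "(\<Sum>l'\<in>L. cmod (G l l')) \<le> real (card J) + real (card L) * T" if "l \<in> L" for l
  proof -
    have "(\<Sum>l'\<in>L. cmod (G l l')) = cmod (G l l) + (\<Sum>l'\<in>L - {l}. cmod (G l l'))"
      using finL that by (rule sum.remove)
    also have "cmod (G l l) = real (card J)" by (simp add: G_diff)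
    also have "(\<Sum>l'\<in>L - {l}. cmod (G l l')) \<le> (\<Sum>l'\<in>L - {l}. T)"
      using that by (intro sum_mono G_le) auto
    also have "\<dots> \<le> (\<Sum>l'\<in>L. T)" using assms(3) finL by (intro sum_mono2) auto
    finally show ?thesis by simp
  qed
  have "complex_of_real (\<Sum>j\<in>J. (cmod (\<Sum>l\<in>L. dft_char N (j * l) * u l))\<^sup>2)
     = (\<Sum>j\<in>J. (\<Sum>l\<in>L. dft_char N (j * l) * u l) * cnj (\<Sum>l\<in>L. dft_char N (j * l) * u l))"
    by (simp add: complex_norm_square del: of_real_power cnj_sum)
  also have "\<dots> = (\<Sum>j\<in>J. \<Sum>l\<in>L. \<Sum>l'\<in>L. u l * cnj (u l') * (dft_char N (j * l) * cnj (dft_char N (j * l'))))"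
    by (simp add: sum_product mult_ac)
  also have "\<dots> = (\<Sum>l\<in>L. \<Sum>l'\<in>L. u l * cnj (u l') * G l l')"
    unfolding G_def sum_distrib_left
    by (rule trans[OF sum.swap sum.cong[OF refl sum.swap]])
  finally have "cmod (complex_of_real (\<Sum>j\<in>J. (cmod (\<Sum>l\<in>L. dft_char N (j * l) * u l))\<^sup>2))
      = cmod (\<Sum>l\<in>L. \<Sum>l'\<in>L. u l * cnj (u l') * G l l')"
    by (rule arg_cong)
  then have "(\<Sum>j\<in>J. (cmod (\<Sum>l\<in>L. dft_char N (j * l) * u l))\<^sup>2)
      = cmod (\<Sum>l\<in>L. \<Sum>l'\<in>L. u l * cnj (u l') * G l l')"
    by (simp only: norm_of_real abs_of_nonneg[OF sum_nonneg[OF zero_le_power2]])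
  also have "\<dots> \<le> (\<Sum>l\<in>L. \<Sum>l'\<in>L. cmod (u l) * cmod (u l') * cmod (G l l'))"
    by (intro sum_norm_le order.trans[OF norm_sum] sum_mono) (simp add: norm_mult)
  also have "\<dots> \<le> (\<Sum>l\<in>L. \<Sum>l'\<in>L. ((cmod (u l))\<^sup>2 + (cmod (u l'))\<^sup>2) / 2 * cmod (G l l'))"
  proof (intro sum_mono mult_right_mono norm_ge_zero)
    fix l l'
    show "cmod (u l) * cmod (u l') \<le> ((cmod (u l))\<^sup>2 + (cmod (u l'))\<^sup>2) / 2"
      using sum_squares_bound[of "cmod (u l)" "cmod (u l')"] by simp
  qed
  also have "\<dots> = (\<Sum>l\<in>L. \<Sum>l'\<in>L. (cmod (u l))\<^sup>2 * cmod (G l l')) / 2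
      + (\<Sum>l\<in>L. \<Sum>l'\<in>L. (cmod (u l'))\<^sup>2 * cmod (G l l')) / 2"
    by (simp add: sum.distrib sum_divide_distrib add_divide_distrib ring_distribs)
  also have "(\<Sum>l\<in>L. \<Sum>l'\<in>L. (cmod (u l'))\<^sup>2 * cmod (G l l'))
      = (\<Sum>l\<in>L. \<Sum>l'\<in>L. (cmod (u l))\<^sup>2 * cmod (G l l'))"
    by (subst sum.swap, intro sum.cong refl, subst G_norm_sym) (rule refl)
  also have "(\<Sum>l\<in>L. \<Sum>l'\<in>L. (cmod (u l))\<^sup>2 * cmod (G l l')) / 2
      + (\<Sum>l\<in>L. \<Sum>l'\<in>L. (cmod (u l))\<^sup>2 * cmod (G l l')) / 2
      = (\<Sum>l\<in>L. (cmod (u l))\<^sup>2 * (\<Sum>l'\<in>L. cmod (G l l')))"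
    by (simp add: sum_distrib_left)
  also have "\<dots> \<le> (\<Sum>l\<in>L. (cmod (u l))\<^sup>2 * (real (card J) + real (card L) * T))"
    by (intro sum_mono mult_left_mono G_row) auto
  finally show ?thesis by (simp add: sum_distrib_left mult_ac)
qed

text \<open>
  This says that the squared operator norm of the Fourier matrix restricted to \<open>X\<close> is at most
  \<open>b\<close>. The normalising factor \<open>1 / sqrt N\<close> of the Fourier transform has been moved to the right.
\<close>
definition dft_energy_le :: "nat \<Rightarrow> nat set \<Rightarrow> real \<Rightarrow> bool" where
  "dft_energy_le N X b \<longleftrightarrow> (\<forall>u. (\<Sum>j\<in>X. (cmod (\<Sum>l\<in>X. dft_char N (j * l) * u l))\<^sup>2)
      \<le> real N * b * (\<Sum>l\<in>X. (cmod (u l))\<^sup>2))"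

lemma dft_energy_le_char_sums:
  assumes "X \<subseteq> {..<N}" "T \<ge> 0"
    and "\<And>m. 0 < m \<Longrightarrow> m < N \<Longrightarrow> cmod (\<Sum>j\<in>X. dft_char N (j * m)) \<le> T"
    and "real (card X) * (1 + T) \<le> real N * b"
  shows "dft_energy_le N X b"
  unfolding dft_energy_le_def
proof
  fix u
  have "(\<Sum>j\<in>X. (cmod (\<Sum>l\<in>X. dft_char N (j * l) * u l))\<^sup>2)
    \<le> (real (card X) + real (card X) * T) * (\<Sum>l\<in>X. (cmod (u l))\<^sup>2)"
    by (intro restricted_dft_bound assms) (use assms finite_subset in auto)
  also have "\<dots> \<le> real N * b * (\<Sum>l\<in>X. (cmod (u l))\<^sup>2)"
    using assms(4) by (intro mult_right_mono sum_nonneg) (auto simp: algebra_simps)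
  finally show "(\<Sum>j\<in>X. (cmod (\<Sum>l\<in>X. dft_char N (j * l) * u l))\<^sup>2)
      \<le> real N * b * (\<Sum>l\<in>X. (cmod (u l))\<^sup>2)" .
qed

text \<open>
  The Fourier matrix is unitary and restriction does not increase its norm.
\<close>
lemma dft_energy_le_1:
  assumes "X \<subseteq> {..<N}"
  shows "dft_energy_le N X 1"
  unfolding dft_energy_le_def
proof
  fix u
  have "(\<Sum>j\<in>X. (cmod (\<Sum>l\<in>X. dft_char N (j * l) * u l))\<^sup>2)
      \<le> (\<Sum>j<N. (cmod (\<Sum>l\<in>X. dft_char N (j * l) * u l))\<^sup>2)"
    using assms by (intro sum_mono2) auto
  also have "\<dots> \<le> (real (card {..<N}) + real (card X) * 0) * (\<Sum>l\<in>X. (cmod (u l))\<^sup>2)"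
    using assms by (intro restricted_dft_bound) (auto simp: sum_dft_char_eq_0)
  finally show "(\<Sum>j\<in>X. (cmod (\<Sum>l\<in>X. dft_char N (j * l) * u l))\<^sup>2)
      \<le> real N * 1 * (\<Sum>l\<in>X. (cmod (u l))\<^sup>2)" by simp
qed

text \<open>
  Submultiplicativity. Write an input as \<open>l0 + M * l'\<close> and an output as \<open>j' + K * j0\<close>; in the
  product of the two the term \<open>M * K * j0 * l'\<close> is a period, so the character of length \<open>M * K\<close>
  splits into one of length \<open>K\<close> in \<open>j' * l'\<close>, a twiddle factor of modulus \<open>1\<close> in \<open>j' * l0\<close>, and
  one of length \<open>M\<close> in \<open>j0 * l0\<close>, as in the fast Fourier transform. The transform of length \<open>K\<close>
  is applied for each \<open>l0\<close>, then the one of length \<open>M\<close> for each \<open>j'\<close>. This requires \<open>X\<close> to be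
  decomposable in both ways, with the digit from \<open>A\<close> lowest and with the digit from \<open>A\<close> highest.
\<close>
lemma dft_energy_le_product:
  assumes "A \<subseteq> {..<M}" "C \<subseteq> {..<K}" "a \<ge> 0" "M > 0" "K > 0"
    and A: "dft_energy_le M A a" and C: "dft_energy_le K C b"
    and X1: "X = (\<lambda>(l0, l'). l0 + M * l') ` (A \<times> C)"
    and X2: "X = (\<lambda>(j', j0). j' + K * j0) ` (C \<times> A)"
  shows "dft_energy_le (M * K) X (a * b)"
  unfolding dft_energy_le_def
proof
  fix u :: "nat \<Rightarrow> complex"
  have inj1: "inj_on (\<lambda>(l0, l'). l0 + M * l') (A \<times> C)"
  proof (rule inj_onI, clarsimp)
    fix x y x' y' assume "x \<in> A" "x' \<in> A" and eq: "x + M * y = x' + M * y'"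
    then have "x < M" "x' < M" using assms(1) by auto
    with arg_cong[OF eq, of "\<lambda>n. n mod M"] arg_cong[OF eq, of "\<lambda>n. n div M"] \<open>M > 0\<close>
    show "x = x' \<and> y = y'" by simp
  qed
  have inj2: "inj_on (\<lambda>(j', j0). j' + K * j0) (C \<times> A)"
  proof (rule inj_onI, clarsimp)
    fix x y x' y' assume "x \<in> C" "x' \<in> C" and eq: "x + K * y = x' + K * y'"
    then have "x < K" "x' < K" using assms(2) by auto
    with arg_cong[OF eq, of "\<lambda>n. n mod K"] arg_cong[OF eq, of "\<lambda>n. n div K"] \<open>K > 0\<close>
    show "x = x' \<and> y = y'" by simp
  qed
  have sum1: "(\<Sum>x\<in>X. h x) = (\<Sum>l0\<in>A. \<Sum>l'\<in>C. h (l0 + M * l'))" for h :: "nat \<Rightarrow> 'b::comm_monoid_add"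
    unfolding X1 sum.reindex[OF inj1] by (simp add: sum.cartesian_product case_prod_unfold)
  have sum2: "(\<Sum>x\<in>X. h x) = (\<Sum>j'\<in>C. \<Sum>j0\<in>A. h (j' + K * j0))" for h :: "nat \<Rightarrow> 'b::comm_monoid_add"
    unfolding X2 sum.reindex[OF inj2] by (simp add: sum.cartesian_product case_prod_unfold)
  \<comment> \<open>\<open>w\<close> is the result of the inner transform, \<open>v\<close> includes the twiddle factor\<close>
  define w where "w j' l0 = (\<Sum>l'\<in>C. dft_char K (j' * l') * u (l0 + M * l'))" for j' l0
  define v where "v j' l0 = dft_char (M * K) (j' * l0) * w j' l0" for j' l0
  have char: "dft_char (M * K) ((j' + K * j0) * (l0 + M * l'))
      = dft_char M (j0 * l0) * dft_char (M * K) (j' * l0) * dft_char K (j' * l')" for j' j0 l0 l'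
  proof -
    have eq: "(j' + K * j0) * (l0 + M * l')
        = K * (j0 * l0) + j' * l0 + M * (j' * l') + M * K * (j0 * l')"
      by (simp add: algebra_simps)
    have "dft_char (M * K) (M * (j' * l')) = dft_char K (j' * l')"
      using dft_char_mult_left[of M K "j' * l'"] \<open>M > 0\<close> by (simp only: mult.commute[of K M])
    then show ?thesis
      unfolding eq dft_char_add using assms(4,5) by (simp add: dft_char_mult_left)
  qed
  have inner: "(\<Sum>l\<in>X. dft_char (M * K) ((j' + K * j0) * l) * u l)
      = (\<Sum>l0\<in>A. dft_char M (j0 * l0) * v j' l0)" for j' j0
    unfolding sum1 char by (simp add: v_def w_def sum_distrib_left mult_ac)
  have "(\<Sum>j\<in>X. (cmod (\<Sum>l\<in>X. dft_char (M * K) (j * l) * u l))\<^sup>2)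
      = (\<Sum>j'\<in>C. \<Sum>j0\<in>A. (cmod (\<Sum>l0\<in>A. dft_char M (j0 * l0) * v j' l0))\<^sup>2)"
    by (subst sum2) (simp add: inner)
  also have "\<dots> \<le> (\<Sum>j'\<in>C. real M * a * (\<Sum>l0\<in>A. (cmod (v j' l0))\<^sup>2))"
    using A unfolding dft_energy_le_def by (intro sum_mono) auto
  also have "\<dots> = real M * a * (\<Sum>l0\<in>A. \<Sum>j'\<in>C. (cmod (w j' l0))\<^sup>2)"
    by (subst sum.swap) (simp add: sum_distrib_left v_def norm_mult)
  also have "\<dots> \<le> real M * a * (\<Sum>l0\<in>A. real K * b * (\<Sum>l'\<in>C. (cmod (u (l0 + M * l')))\<^sup>2))"
    using C assms(3) unfolding dft_energy_le_def w_def by (intro mult_left_mono sum_mono) auto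
  also have "\<dots> = real (M * K) * (a * b) * (\<Sum>l\<in>X. (cmod (u l))\<^sup>2)"
    by (simp add: sum1 sum_distrib_left mult_ac)
  finally show "(\<Sum>j\<in>X. (cmod (\<Sum>l\<in>X. dft_char (M * K) (j * l) * u l))\<^sup>2)
      \<le> real (M * K) * (a * b) * (\<Sum>l\<in>X. (cmod (u l))\<^sup>2)" .
qed


section \<open>Discrete Cantor sets and the sharp exponent\<close>

lemma cantor_set_0: "cantor_set M \<A> 0 = {0}"
  by (simp add: cantor_set_def)

lemma cantor_set_Suc_high:
  "cantor_set M \<A> (Suc k) = (\<lambda>(j', j0). j' + M ^ k * j0) ` (cantor_set M \<A> k \<times> \<A>)"
proof (intro subset_antisym subsetI)
  fix x assume "x \<in> cantor_set M \<A> (Suc k)"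
  then obtain a where a: "\<forall>j<Suc k. a j \<in> \<A>" "x = (\<Sum>j<Suc k. a j * M ^ j)"
    by (auto simp: cantor_set_def)
  then have "(\<Sum>j<k. a j * M ^ j) \<in> cantor_set M \<A> k" "a k \<in> \<A>"
    by (auto simp: cantor_set_def)
  moreover have "x = (\<Sum>j<k. a j * M ^ j) + M ^ k * a k" using a by simp
  ultimately show "x \<in> (\<lambda>(j', j0). j' + M ^ k * j0) ` (cantor_set M \<A> k \<times> \<A>)" by force
next
  fix x assume "x \<in> (\<lambda>(j', j0). j' + M ^ k * j0) ` (cantor_set M \<A> k \<times> \<A>)"
  then obtain a c where a: "\<forall>j<k. a j \<in> \<A>" "c \<in> \<A>" "x = (\<Sum>j<k. a j * M ^ j) + M ^ k * c"
    by (auto simp: cantor_set_def)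
  let ?a = "a(k := c)"
  have "x = (\<Sum>j<Suc k. ?a j * M ^ j)" using a by simp
  moreover have "\<forall>j<Suc k. ?a j \<in> \<A>" using a by (simp add: less_Suc_eq)
  ultimately show "x \<in> cantor_set M \<A> (Suc k)" unfolding cantor_set_def by blast
qed

lemma cantor_set_Suc_low:
  "cantor_set M \<A> (Suc k) = (\<lambda>(l0, l'). l0 + M * l') ` (\<A> \<times> cantor_set M \<A> k)"
proof (intro subset_antisym subsetI)
  fix x assume "x \<in> cantor_set M \<A> (Suc k)"
  then obtain a where a: "\<forall>j<Suc k. a j \<in> \<A>" "x = (\<Sum>j<Suc k. a j * M ^ j)"
    by (auto simp: cantor_set_def)
  then have "(\<Sum>j<k. a (Suc j) * M ^ j) \<in> cantor_set M \<A> k" "a 0 \<in> \<A>"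
    by (auto simp: cantor_set_def)
  moreover have "x = a 0 + M * (\<Sum>j<k. a (Suc j) * M ^ j)"
    unfolding a(2) sum.lessThan_Suc_shift by (simp add: sum_distrib_left mult_ac)
  ultimately show "x \<in> (\<lambda>(l0, l'). l0 + M * l') ` (\<A> \<times> cantor_set M \<A> k)" by force
next
  fix x assume "x \<in> (\<lambda>(l0, l'). l0 + M * l') ` (\<A> \<times> cantor_set M \<A> k)"
  then obtain a c where a: "\<forall>j<k. a j \<in> \<A>" "c \<in> \<A>" "x = c + M * (\<Sum>j<k. a j * M ^ j)"
    by (auto simp: cantor_set_def)
  let ?a = "case_nat c a"
  have "x = (\<Sum>j<Suc k. ?a j * M ^ j)"
    unfolding a(3) sum.lessThan_Suc_shift by (simp add: sum_distrib_left mult_ac)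
  moreover have "\<forall>j<Suc k. ?a j \<in> \<A>" using a by (simp add: split: nat.split)
  ultimately show "x \<in> cantor_set M \<A> (Suc k)" unfolding cantor_set_def by blast
qed

lemma cantor_set_1: "cantor_set M \<A> 1 = \<A>"
  by (simp add: cantor_set_Suc_high cantor_set_0 image_def)

lemma cantor_set_subset:
  assumes "\<A> \<subseteq> {..<M}"
  shows "cantor_set M \<A> k \<subseteq> {..<M ^ k}"
proof (induction k)
  case 0
  then show ?case by (simp add: cantor_set_0)
next
  case (Suc k)
  have "j' + M ^ k * j0 < M ^ Suc k" if "j' < M ^ k" "j0 < M" for j' j0
  proof -
    have "j' + M ^ k * j0 < M ^ k * Suc j0" using that by simp
    also have "\<dots> \<le> M ^ k * M" using that by (intro mult_left_mono) auto
    finally show ?thesis by (simp add: mult.commute)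
  qed
  with Suc assms show ?case by (force simp: cantor_set_Suc_high)
qed

lemma dft_energy_le_cantor_set:
  assumes "M > 0" "\<A> \<subseteq> {..<M}" "b \<ge> 0" "dft_energy_le M \<A> b"
  shows "dft_energy_le (M ^ k) (cantor_set M \<A> k) (b ^ k)"
proof (induction k)
  case 0
  then show ?case by (simp add: dft_energy_le_def cantor_set_0)
next
  case (Suc k)
  have "dft_energy_le (M * M ^ k) (cantor_set M \<A> (Suc k)) (b * b ^ k)"
    by (rule dft_energy_le_product[OF assms(2) cantor_set_subset[OF assms(2)] assms(3,1) _
          assms(4) Suc cantor_set_Suc_low cantor_set_Suc_high])
       (use assms in auto)
  then show ?case by simp
qed

lemma l2_norm_restricted_dft:
  assumes "X \<subseteq> {..<N}"
  shows "l2_norm N ((mult_indicator X \<circ> dft N \<circ> mult_indicator X) u)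
    = sqrt ((\<Sum>j\<in>X. (cmod (\<Sum>l\<in>X. dft_char N (j * l) * u l))\<^sup>2) / real N)"
proof -
  have [simp]: "finite X" using assms finite_subset by blast
  have char: "exp (- (2 * complex_of_real pi * \<i> * of_nat j * of_nat l / of_nat N)) = dft_char N (j * l)" for j l
    by (simp add: dft_char_def cis_conv_exp mult_ac)
  have dft: "dft N (mult_indicator X u) j = 1 / complex_of_real (sqrt (real N)) *
      (\<Sum>l\<in>X. dft_char N (j * l) * u l)" if "j \<in> X" for j
  proof -
    have "(\<Sum>l<N. dft_char N (j * l) * (indicator X l * u l)) = (\<Sum>l\<in>X. dft_char N (j * l) * u l)"
      using assms by (intro sum.mono_neutral_cong_right) auto
    then show ?thesis using that assms by (auto simp: dft_def mult_indicator_def char)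
  qed
  have "(\<Sum>j<N. (cmod (mult_indicator X (dft N (mult_indicator X u)) j))\<^sup>2)
      = (\<Sum>j\<in>X. (cmod (dft N (mult_indicator X u) j))\<^sup>2)"
    using assms by (intro sum.mono_neutral_cong_right) (auto simp: mult_indicator_def)
  also have "\<dots> = (\<Sum>j\<in>X. (cmod (\<Sum>l\<in>X. dft_char N (j * l) * u l))\<^sup>2 / real N)"
    by (intro sum.cong refl) (simp add: dft norm_mult norm_divide power_mult_distrib power_divide)
  finally show ?thesis by (simp add: l2_norm_def sum_divide_distrib)
qed

lemma restricted_dft_ratio_le:
  assumes "X \<subseteq> {..<N}" "N > 0" "b \<ge> 0" "dft_energy_le N X b"
  shows "l2_norm N ((mult_indicator X \<circ> dft N \<circ> mult_indicator X) u) / l2_norm N u \<le> sqrt b"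
proof (cases "l2_norm N u = 0")
  case False
  have "l2_norm N u \<ge> 0" by (simp add: l2_norm_def sum_nonneg)
  with False have pos: "l2_norm N u > 0" by simp
  have "(\<Sum>j\<in>X. (cmod (\<Sum>l\<in>X. dft_char N (j * l) * u l))\<^sup>2) / real N \<le> b * (\<Sum>l\<in>X. (cmod (u l))\<^sup>2)"
    using assms(2,4) by (simp add: dft_energy_le_def divide_le_eq mult_ac)
  also have "\<dots> \<le> b * (\<Sum>l<N. (cmod (u l))\<^sup>2)"
    using assms by (intro mult_left_mono sum_mono2) auto
  finally have "l2_norm N ((mult_indicator X \<circ> dft N \<circ> mult_indicator X) u) \<le> sqrt b * l2_norm N u"
    unfolding l2_norm_restricted_dft[OF assms(1)] by (simp add: l2_norm_def real_sqrt_mult[symmetric])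
  then show ?thesis using pos by (simp add: divide_le_eq)
qed (use assms in auto)

lemma l2_onorm_restricted_dft_le:
  assumes "X \<subseteq> {..<N}" "N > 0" "b \<ge> 0" "dft_energy_le N X b"
  shows "l2_onorm N (mult_indicator X \<circ> dft N \<circ> mult_indicator X) \<le> sqrt b"
proof -
  have "(\<lambda>_. 0) \<in> l2_space N" by (simp add: l2_space_def)
  then show ?thesis unfolding l2_onorm_def
    by (intro cSUP_least restricted_dft_ratio_le assms) auto
qed

lemma l2_onorm_restricted_dft_pos:
  assumes "X \<subseteq> {..<N}" "X \<noteq> {}"
  shows "0 < l2_onorm N (mult_indicator X \<circ> dft N \<circ> mult_indicator X)"
proof -
  obtain a where a: "a \<in> X" using assms by auto
  have N: "N > 0" and aN: "a < N" and fin: "finite X"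
    using a assms finite_subset[OF assms(1)] by auto
  define u :: "nat \<Rightarrow> complex" where "u = (\<lambda>j. if j = a then 1 else 0)"
  let ?T = "mult_indicator X \<circ> dft N \<circ> mult_indicator X"
  have u: "u \<in> l2_space N" using aN by (auto simp: l2_space_def u_def)
  have "(cmod (u j))\<^sup>2 = (if j = a then 1 else 0)" for j by (simp add: u_def)
  then have nu: "l2_norm N u = 1" using aN by (simp add: l2_norm_def)
  have "(\<Sum>l\<in>X. dft_char N (j * l) * u l) = dft_char N (j * a)" for j
    using a fin by (simp add: u_def if_distrib cong: if_cong)
  then have "l2_norm N (?T u) / l2_norm N u = sqrt (real (card X) / real N)"
    unfolding l2_norm_restricted_dft[OF assms(1)] nu by simp
  moreover have "\<dots> > 0" using N fin assms(2) by (simp add: card_gt_0_iff)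
  moreover have "l2_norm N (?T u) / l2_norm N u \<le> l2_onorm N ?T"
    unfolding l2_onorm_def
    by (intro cSUP_upper u bdd_aboveI2[where M = "sqrt 1"] restricted_dft_ratio_le
        dft_energy_le_1 assms N) simp
  ultimately show ?thesis by linarith
qed

lemma fup_norm_le:
  assumes "M > 0" "\<A> \<subseteq> {..<M}" "dft_energy_le M \<A> (real M powr (- 2 * \<beta>))"
  shows "fup_norm M \<A> k \<le> real (M ^ k) powr (- \<beta>)"
proof -
  have "fup_norm M \<A> k \<le> sqrt ((real M powr (- 2 * \<beta>)) ^ k)"
    unfolding fup_norm_def using assms
    by (intro l2_onorm_restricted_dft_le cantor_set_subset dft_energy_le_cantor_set) auto
  also have "(real M powr (- 2 * \<beta>)) ^ k = real M powr (real k * (- 2 * \<beta>))"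
    using assms(1) by (intro powr_power) auto
  also have "\<dots> = (real M powr (real k * - \<beta>))\<^sup>2"
    by (simp add: power2_eq_square powr_add[symmetric] mult_ac)
  also have "real M powr (real k * - \<beta>) = real (M ^ k) powr (- \<beta>)"
    unfolding powr_powr[symmetric] using assms(1) by (simp add: powr_realpow)
  finally show ?thesis by simp
qed

text \<open>
  The first level \<open>k = 1\<close> suffices because of submultiplicativity. As the supremum is taken in
  the reals, it must also be seen to be over a set that is bounded above, which holds because
  the norm at level \<open>1\<close> is positive. The set contains \<open>0\<close>, which covers negative \<open>\<beta>\<close>.
\<close>
theorem sharp_exponent_ge:
  assumes "M \<ge> 2" "\<A> \<subseteq> {..<M}" "\<A> \<noteq> {}"
    and energy: "dft_energy_le M \<A> (real M powr (- 2 * \<beta>))"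
  shows "sharp_exponent M \<A> \<ge> \<beta>"
proof -
  let ?E = "{\<beta>. 0 \<le> \<beta> \<and> (\<forall>k\<ge>1. fup_norm M \<A> k \<le> real (M ^ k) powr (- \<beta>))}"
  have zero: "0 \<in> ?E"
    using fup_norm_le[of M \<A> 0] dft_energy_le_1[OF assms(2)] assms(1,2) by auto
  have pos: "0 < fup_norm M \<A> 1"
    unfolding fup_norm_def cantor_set_1 using assms(2,3)
    by (intro l2_onorm_restricted_dft_pos) auto
  have bdd: "bdd_above ?E"
  proof (rule bdd_aboveI)
    fix x assume "x \<in> ?E"
    then have "fup_norm M \<A> 1 \<le> real M powr (- x)" by force
    then have "ln (fup_norm M \<A> 1) \<le> ln (real M powr (- x))"
      using pos by (intro ln_mono) auto
    also have "\<dots> = - x * ln (real M)" using assms(1) by (simp add: ln_powr)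
    finally have "x * ln (real M) \<le> - ln (fup_norm M \<A> 1)" by linarith
    moreover have "0 < ln (real M)" using assms(1) by simp
    ultimately show "x \<le> - ln (fup_norm M \<A> 1) / ln (real M)"
      by (simp only: pos_le_divide_eq)
  qed
  show ?thesis
  proof (cases "\<beta> \<ge> 0")
    case True
    then have "\<beta> \<in> ?E" using fup_norm_le[OF _ assms(2) energy] assms(1) by auto
    then show ?thesis unfolding sharp_exponent_def by (rule cSup_upper[OF _ bdd])
  next
    case False
    have "0 \<le> sharp_exponent M \<A>" unfolding sharp_exponent_def by (rule cSup_upper[OF zero bdd])
    with False show ?thesis by simp
  qed
qed

section \<open>Random alphabets\<close>

text \<open>
  If a complex number exceeds \<open>s\<close> in modulus, then its real or imaginary part exceeds
  \<open>t = s / sqrt 2\<close> in absolute value. This leaves four one-sided tails, and the exponent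
  \<open>t\<^sup>2 / (2 * A)\<close> becomes \<open>s\<^sup>2 / (4 * A)\<close>. The populations have mean zero because the character is
  nontrivial.
\<close>
lemma card_large_char_sum:
  assumes "0 < m" "m < M" "0 < A" "A \<le> M" "s \<ge> 0"
  shows "real (card {S. S \<subseteq> {0..<M} \<and> card S = A \<and> s < cmod (\<Sum>j\<in>S. dft_char M (j * m))})
    \<le> 4 * real (M choose A) * exp (- s\<^sup>2 / (4 * real A))"
proof -
  define t where "t = s / sqrt 2"
  define tail where "tail f = {S. S \<subseteq> {0..<M} \<and> card S = A \<and> t \<le> (\<Sum>j\<in>S. f j)}" for f :: "nat \<Rightarrow> real"
  let ?c = "\<lambda>j. dft_char M (j * m)"
  define B where "B = real (M choose A) * exp (- s\<^sup>2 / (4 * real A))"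
  have zero: "(\<Sum>j = 0..<M. ?c j) = 0"
    using sum_dft_char_eq_0[OF assms(1,2)] by (simp add: lessThan_atLeast0)
  have tail: "real (card (tail f)) \<le> B" if "\<And>j. \<bar>f j\<bar> \<le> 1" "(\<Sum>j = 0..<M. f j) = 0" for f
    using hoeffding_without_replacement[of "{0..<M}" A t f] that assms
    by (simp add: tail_def t_def B_def power_divide)
  have c1: "\<bar>Re (?c j)\<bar> \<le> 1" "\<bar>Im (?c j)\<bar> \<le> 1" for j
    using abs_Re_le_cmod[of "?c j"] abs_Im_le_cmod[of "?c j"] by auto
  have c0: "(\<Sum>j = 0..<M. Re (?c j)) = 0" "(\<Sum>j = 0..<M. Im (?c j)) = 0"
    using arg_cong[OF zero, of Re] arg_cong[OF zero, of Im] by simp_all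
  have fin: "finite (tail f)" for f
    by (rule finite_subset[of _ "Pow {0..<M}"]) (auto simp: tail_def)
  have "{S. S \<subseteq> {0..<M} \<and> card S = A \<and> s < cmod (\<Sum>j\<in>S. ?c j)}
      \<subseteq> tail (\<lambda>j. Re (?c j)) \<union> tail (\<lambda>j. - Re (?c j)) \<union> (tail (\<lambda>j. Im (?c j)) \<union> tail (\<lambda>j. - Im (?c j)))"
    (is "?S \<subseteq> ?U")
  proof
    fix S assume S: "S \<in> ?S"
    let ?z = "\<Sum>j\<in>S. ?c j"
    have "t \<le> \<bar>Re ?z\<bar> \<or> t \<le> \<bar>Im ?z\<bar>"
    proof (rule ccontr)
      assume "\<not> ?thesis"
      then have "(Re ?z)\<^sup>2 \<le> t\<^sup>2" "(Im ?z)\<^sup>2 \<le> t\<^sup>2"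
        using assms(5) by (auto simp: abs_le_square_iff[symmetric] t_def)
      then have "(cmod ?z)\<^sup>2 \<le> s\<^sup>2" unfolding cmod_power2 by (simp add: t_def power_divide)
      then have "cmod ?z \<le> s" using assms(5) by (rule power2_le_imp_le)
      with S show False by simp
    qed
    with S show "S \<in> ?U" by (auto simp: tail_def sum_negf abs_if split: if_splits)
  qed
  then have "card ?S \<le> card ?U" using fin by (intro card_mono) auto
  also have "\<dots> \<le> card (tail (\<lambda>j. Re (?c j))) + card (tail (\<lambda>j. - Re (?c j)))
      + (card (tail (\<lambda>j. Im (?c j))) + card (tail (\<lambda>j. - Im (?c j))))"
    by (intro order.trans[OF card_Un_le] add_mono card_Un_le)
  finally have "real (card ?S) \<le> real (card (tail (\<lambda>j. Re (?c j)))) + real (card (tail (\<lambda>j. - Re (?c j))))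
      + (real (card (tail (\<lambda>j. Im (?c j)))) + real (card (tail (\<lambda>j. - Im (?c j)))))"
    by linarith
  also have "\<dots> \<le> B + B + (B + B)"
    by (intro add_mono tail) (simp_all add: c1 c0 sum_negf)
  finally show ?thesis by (simp add: B_def)
qed

theorem measure_large_char_sums:
  assumes "0 < A" "A \<le> M" "s \<ge> 0"
  defines "G \<equiv> {\<A> \<in> alphabets M A. \<forall>m. 0 < m \<longrightarrow> m < M \<longrightarrow> cmod (\<Sum>j\<in>\<A>. dft_char M (j * m)) \<le> s}"
  shows "measure (alphabet_measure M A) (alphabets M A - G)
    \<le> 4 * real M * exp (- s\<^sup>2 / (4 * real A))"
proof -
  define bad where "bad m = {S. S \<subseteq> {0..<M} \<and> card S = A \<and> s < cmod (\<Sum>j\<in>S. dft_char M (j * m))}" for m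
  have fin: "finite (bad m)" for m
    by (rule finite_subset[of _ "Pow {0..<M}"]) (auto simp: bad_def)
  have "alphabets M A - G \<subseteq> (\<Union>m\<in>{1..<M}. bad m)"
    by (force simp: G_def bad_def alphabets_def not_le)
  then have "card (alphabets M A - G) \<le> card (\<Union>m\<in>{1..<M}. bad m)"
    using fin by (intro card_mono) auto
  also have "\<dots> \<le> (\<Sum>m\<in>{1..<M}. card (bad m))" by (intro card_UN_le) auto
  finally have "real (card (alphabets M A - G)) \<le> (\<Sum>m\<in>{1..<M}. real (card (bad m)))"
    by (simp flip: of_nat_sum)
  also have "\<dots> \<le> (\<Sum>m\<in>{1..<M}. 4 * real (M choose A) * exp (- s\<^sup>2 / (4 * real A)))"
    unfolding bad_def by (intro sum_mono card_large_char_sum assms) auto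
  also have "\<dots> \<le> real M * (4 * real (M choose A) * exp (- s\<^sup>2 / (4 * real A)))"
    unfolding sum_constant by (intro mult_right_mono) auto
  finally have "real (card (alphabets M A - G)) \<le> (4 * real M * exp (- s\<^sup>2 / (4 * real A))) * real (M choose A)"
    by (simp add: mult_ac)
  then show ?thesis
    using assms(2) by (subst measure_alphabet_measure) (auto simp: divide_le_eq zero_less_binomial_iff)
qed

theorem theorem1p2:
  fixes M A :: nat and \<delta> \<epsilon> :: real
  assumes "M \<ge> 3" and "A \<ge> 1"
    and "\<delta> = ln (real A) / ln (real M)"
    and "0 < \<delta>" and "\<delta> < 2 / 3"
    and "\<epsilon> > 0"
  shows "\<exists>G \<subseteq> alphabets M A.
    measure (alphabet_measure M A) (alphabets M A - G)
      \<le> 4 * real M * exp (- (real M powr (4 * \<epsilon>)) / 64) \<and>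
    (\<forall>\<A>\<in>G. sharp_exponent M \<A> \<ge> 1 / 2 - 3 / 4 * \<delta> - \<epsilon>)"
proof -
  have lnM: "ln (real M) > 0" using assms(1) by simp
  have A2: "A \<ge> 2"
  proof (rule ccontr)
    assume "\<not> A \<ge> 2"
    then have "A = 1" using assms(2) by simp
    then show False using assms(3,4) by simp
  qed
  have AM: "real A = real M powr \<delta>"
    using assms(1-3) lnM by (simp add: powr_def)
  also have "\<dots> \<le> real M powr 1" using assms(1,5) by (intro powr_mono) auto
  finally have AleM: "A \<le> M" using assms(1) by simp
  define X where "X = real M powr (2 * \<epsilon>)"
  have X1: "X \<ge> 1" unfolding X_def using assms(1,6) by (intro ge_one_powr_ge_zero) auto
  \<comment> \<open>the factor \<open>1 / 4\<close> makes the tail exponent \<open>s\<^sup>2 / (4 * A)\<close> equal to \<open>X\<^sup>2 / 64\<close>\<close>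
  define s where "s = sqrt (real A) * X / 4"
  have s0: "s \<ge> 0" using X1 by (simp add: s_def)
  define G where "G = {\<A> \<in> alphabets M A. \<forall>m. 0 < m \<longrightarrow> m < M \<longrightarrow> cmod (\<Sum>j\<in>\<A>. dft_char M (j * m)) \<le> s}"
  have "measure (alphabet_measure M A) (alphabets M A - G) \<le> 4 * real M * exp (- s\<^sup>2 / (4 * real A))"
    unfolding G_def using assms(2) AleM s0 by (intro measure_large_char_sums) auto
  also have "s\<^sup>2 / (4 * real A) = X\<^sup>2 / 64"
    using assms(2) by (simp add: s_def power_divide power_mult_distrib)
  then have "- s\<^sup>2 / (4 * real A) = - (real M powr (4 * \<epsilon>)) / 64"
    using assms(1) by (simp add: X_def power2_eq_square powr_add[symmetric])
  finally have meas: "measure (alphabet_measure M A) (alphabets M A - G)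
      \<le> 4 * real M * exp (- (real M powr (4 * \<epsilon>)) / 64)" .
  \<comment> \<open>the diagonal of the Gram matrix fits into the budget since \<open>A \<ge> 2\<close>\<close>
  have "4 / 3 \<le> sqrt 2" by (rule real_le_rsqrt) (simp add: power2_eq_square)
  also have "\<dots> \<le> sqrt (real A)" using A2 by simp
  finally have "4 / 3 * 1 \<le> sqrt (real A) * X" using X1 by (intro mult_mono) auto
  then have "1 + s \<le> sqrt (real A) * X" by (simp add: s_def)
  then have "real A * (1 + s) \<le> real A * (sqrt (real A) * X)" by (intro mult_left_mono) auto
  also have "\<dots> = real M powr (\<delta> + \<delta> / 2 + 2 * \<epsilon>)"
  proof -
    have "sqrt (real A) = real M powr (\<delta> / 2)"
      by (simp add: AM powr_half_sqrt[symmetric] powr_powr)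
    then show ?thesis unfolding X_def powr_add by (simp only: AM mult.assoc)
  qed
  also have "\<dots> = real M powr (1 + (- 2 * (1 / 2 - 3 / 4 * \<delta> - \<epsilon>)))"
    by (rule arg_cong) (simp add: algebra_simps)
  also have "\<dots> = real M * real M powr (- 2 * (1 / 2 - 3 / 4 * \<delta> - \<epsilon>))"
    using assms(1) by (simp only: powr_add) simp
  finally have budget: "real A * (1 + s) \<le> real M * real M powr (- 2 * (1 / 2 - 3 / 4 * \<delta> - \<epsilon>))" .
  have "sharp_exponent M \<A> \<ge> 1 / 2 - 3 / 4 * \<delta> - \<epsilon>" if "\<A> \<in> G" for \<A>
  proof (rule sharp_exponent_ge)
    have \<A>: "\<A> \<subseteq> {..<M}" "card \<A> = A" using that by (auto simp: G_def alphabets_def)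
    then show "\<A> \<subseteq> {..<M}" "\<A> \<noteq> {}" using assms(2) by auto
    show "dft_energy_le M \<A> (real M powr (- 2 * (1 / 2 - 3 / 4 * \<delta> - \<epsilon>)))"
      using that s0 budget \<A> by (intro dft_energy_le_char_sums[where T = s]) (auto simp: G_def)
  qed (use assms in auto)
  moreover have "G \<subseteq> alphabets M A" by (auto simp: G_def)
  ultimately show ?thesis using meas by blast
qed

end
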